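(* The cross product function $\times:\mathbb{R}^6\to\mathbb{R}^3$, $\times(\mathbf{a},\mathbf{b})=\mathbf{a}\times\mathbf{b}$ for $\mathbf{a},\mathbf{b}\in\mathbb{R}^3$, is an element of $\mathcal{Q}_{\pm}$, and the corresponding matrices $\mathbf{Q}_i,\mathbf{P}_i\in\mathbb{R}^{6\times 6}$ ($i=1,2,3$) can be written out explicitly (as concrete constant positive semidefinite matrices).
   Context: $\mathcal{Q}_{+}$ is the set of functions $\mathbf{s}:\mathbb{R}^n\to\mathbb{R}^m$ (for any $n,m$) such that for each $i=1,\dots,m$ there exist a symmetric positive semidefinite matrix $\mathbf{Q}_i\in\mathbb{R}^{n\times n}$, a vector $\mathbf{q}_i\in\mathbb{R}^n$ and $c_i\in\mathbb{R}$ with $s_i(\mathbf{x})=\mathbf{x}^T\mathbf{Q}_i\mathbf{x}+\mathbf{q}_i^T\mathbf{x}+c_i$ for all $\mathbf{x}$. $\mathcal{Q}_{\pm}$ is the set of functions $\mathbf{s}:\mathbb{R}^n\to\mathbb{R}^m$ such that there exist $\mathbf{s}'\in\mathcal{Q}_{+}$ (with quadratic matrices $\mathbf{Q}_i$) and symmetric positive semidefinite matrices $\mathbf{P}_i\in\mathbb{R}^{n\times n}$ with $s_i(\mathbf{x})=s'_i(\mathbf{x})-\mathbf{x}^T\mathbf{P}_i\mathbf{x}$ for all $\mathbf{x}$ and $i=1,\dots,m$. A function is regarded as an element of $\mathcal{Q}_\pm$ only if the matrices $\mathbf{Q}_i$ and $\mathbf{P}_i$ are available separately, rather than only the indefinite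 matrix $\mathbf{Q}_i-\mathbf{P}_i$. Here $\mathbb{R}^6$ is identified with pairs $(\mathbf{a},\mathbf{b})\in\mathbb{R}^3\times\mathbb{R}^3$. *)

theory Defs
  imports "HOL-Analysis.Analysis"
begin

definition psd :: "real^'n^'n \<Rightarrow> bool" where
  "psd A \<longleftrightarrow> transpose A = A \<and> (\<forall>x. 0 \<le> x \<bullet> (A *v x))"

text \<open>\<open>Q_plus_rep s Q\<close>: every component of \<open>s\<close> is a convex quadratic function, and \<open>Q i\<close> is
  the quadratic matrix used for component \<open>i\<close>.\<close>

definition Q_plus_rep :: "(real^'n \<Rightarrow> real^'m) \<Rightarrow> ('m \<Rightarrow> real^'n^'n) \<Rightarrow> bool" where
  "Q_plus_rep s Q \<longleftrightarrow>
     (\<forall>i. psd (Q i) \<and> (\<exists>q c. \<forall>x. s x $ i = x \<bullet> (Q i *v x) + q \<bullet> x + c))"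

definition Q_plus :: "(real^'n \<Rightarrow> real^'m) set" where
  "Q_plus = {s. \<exists>Q. Q_plus_rep s Q}"

text \<open>\<open>Q_pm_rep s Q P\<close> keeps the two positive semidefinite families separate, rather than only
  recording the indefinite matrices \<open>Q i - P i\<close>.  Membership of a function \<open>s\<close> in the class,
  understood as coming with its matrices, is thus a statement \<open>Q_pm_rep s Q P\<close> with given \<open>Q\<close>
  and \<open>P\<close>; \<open>Q_pm\<close> is the underlying set of functions.\<close>

definition Q_pm_rep ::
  "(real^'n \<Rightarrow> real^'m) \<Rightarrow> ('m \<Rightarrow> real^'n^'n) \<Rightarrow> ('m \<Rightarrow> real^'n^'n) \<Rightarrow> bool" where
  "Q_pm_rep s Q P \<longleftrightarrow>
     (\<exists>s'. Q_plus_rep s' Q \<and> (\<forall>i. psd (P i)) \<and> (\<forall>x i. s x $ i = s' x $ i - x \<bullet> (P i *v x)))"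

definition Q_pm :: "(real^'n \<Rightarrow> real^'m) set" where
  "Q_pm = {s. \<exists>Q P. Q_pm_rep s Q P}"

text \<open>A point of \<open>real^6\<close> is identified with the pair of its first three and its last three
  coordinates.\<close>

definition pair_of :: "real^6 \<Rightarrow> (real^3) \<times> (real^3)" where
  "pair_of x = (vector [x$1, x$2, x$3], vector [x$4, x$5, x$6])"

definition cross_fun :: "real^6 \<Rightarrow> real^3" where
  "cross_fun x = (case pair_of x of (a, b) \<Rightarrow> cross3 a b)"

text \<open>With \<open>x = (a, b)\<close>, each component of the cross product has the form \<open>u v - w z\<close> for distinct
  coordinates \<open>u, v, w, z\<close> of \<open>x\<close>, and
  \<open>u v - w z = ((u + v)\<^sup>2 + (w - z)\<^sup>2) / 4 - ((u - v)\<^sup>2 + (w + z)\<^sup>2) / 4\<close>.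
  The matrices below are those of the two sums of squares.\<close>

definition cross_Q1 :: "real^6^6" where
  "cross_Q1 = (1/4) *\<^sub>R vector [
     vector [ 0,  0,  0,  0,  0,  0],
     vector [ 0,  1,  0,  0,  0,  1],
     vector [ 0,  0,  1,  0, -1,  0],
     vector [ 0,  0,  0,  0,  0,  0],
     vector [ 0,  0, -1,  0,  1,  0],
     vector [ 0,  1,  0,  0,  0,  1]]"

definition cross_P1 :: "real^6^6" where
  "cross_P1 = (1/4) *\<^sub>R vector [
     vector [ 0,  0,  0,  0,  0,  0],
     vector [ 0,  1,  0,  0,  0, -1],
     vector [ 0,  0,  1,  0,  1,  0],
     vector [ 0,  0,  0,  0,  0,  0],
     vector [ 0,  0,  1,  0,  1,  0],
     vector [ 0, -1,  0,  0,  0,  1]]"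

definition cross_Q2 :: "real^6^6" where
  "cross_Q2 = (1/4) *\<^sub>R vector [
     vector [ 1,  0,  0,  0,  0, -1],
     vector [ 0,  0,  0,  0,  0,  0],
     vector [ 0,  0,  1,  1,  0,  0],
     vector [ 0,  0,  1,  1,  0,  0],
     vector [ 0,  0,  0,  0,  0,  0],
     vector [-1,  0,  0,  0,  0,  1]]"

definition cross_P2 :: "real^6^6" where
  "cross_P2 = (1/4) *\<^sub>R vector [
     vector [ 1,  0,  0,  0,  0,  1],
     vector [ 0,  0,  0,  0,  0,  0],
     vector [ 0,  0,  1, -1,  0,  0],
     vector [ 0,  0, -1,  1,  0,  0],
     vector [ 0,  0,  0,  0,  0,  0],
     vector [ 1,  0,  0,  0,  0,  1]]"

definition cross_Q3 :: "real^6^6" where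
  "cross_Q3 = (1/4) *\<^sub>R vector [
     vector [ 1,  0,  0,  0,  1,  0],
     vector [ 0,  1,  0, -1,  0,  0],
     vector [ 0,  0,  0,  0,  0,  0],
     vector [ 0, -1,  0,  1,  0,  0],
     vector [ 1,  0,  0,  0,  1,  0],
     vector [ 0,  0,  0,  0,  0,  0]]"

definition cross_P3 :: "real^6^6" where
  "cross_P3 = (1/4) *\<^sub>R vector [
     vector [ 1,  0,  0,  0, -1,  0],
     vector [ 0,  1,  0,  1,  0,  0],
     vector [ 0,  0,  0,  0,  0,  0],
     vector [ 0,  1,  0,  1,  0,  0],
     vector [-1,  0,  0,  0,  1,  0],
     vector [ 0,  0,  0,  0,  0,  0]]"

definition cross_Q :: "3 \<Rightarrow> real^6^6" where
  "cross_Q i = vector [cross_Q1, cross_Q2, cross_Q3] $ i"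

definition cross_P :: "3 \<Rightarrow> real^6^6" where
  "cross_P i = vector [cross_P1, cross_P2, cross_P3] $ i"

end

theory Submission
  imports Defs
begin

text \<open>Each component of the cross product is a difference of two products of coordinates,
  \<open>u * v - w * z\<close>. Polarization writes each product as a quarter of the difference of
  the squares of a sum and a difference; collecting the squares with positive sign into
  \<open>cross_Q i\<close> and those with negative sign into \<open>cross_P i\<close> leaves two
  sums of squares. \<open>inner_cross_matrices\<close> evaluates the quadratic forms, from which
  both semidefiniteness and the identity \<open>cross_fun_component\<close> follow.\<close>

lemma exhaust_6:
  fixes i :: 6
  shows "i = 1 \<or> i = 2 \<or> i = 3 \<or> i = 4 \<or> i = 5 \<or> i = 6"
proof (induct i)
  case (of_int z)
  then have "0 \<le> z" and "z < 6"
    by simp_all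
  then have "z = 0 \<or> z = 1 \<or> z = 2 \<or> z = 3 \<or> z = 4 \<or> z = 5"
    by arith
  \<comment> \<open>Arithmetic in type \<open>6\<close> is modulo 6, so the residue
    \<open>z = 0\<close> is the element written \<open>6\<close>.\<close>
  then show ?case
    by auto
qed

lemma forall_6:
  "(\<forall>i::6. P i) \<longleftrightarrow> P 1 \<and> P 2 \<and> P 3 \<and> P 4 \<and> P 5 \<and> P 6"
  by (metis exhaust_6)

lemma UNIV_6: "UNIV = {1, 2, 3, 4, 5, 6 :: 6}"
  using exhaust_6 by auto

lemma sum_6: "sum f (UNIV :: 6 set) = f 1 + f 2 + f 3 + f 4 + f 5 + f 6"
  unfolding UNIV_6 by (simp add: ac_simps)

lemma vector_6 [simp]:
  fixes a b c d e f :: "'a::zero"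
  shows "(vector [a, b, c, d, e, f] :: 'a^6) $ 1 = a"
    and "(vector [a, b, c, d, e, f] :: 'a^6) $ 2 = b"
    and "(vector [a, b, c, d, e, f] :: 'a^6) $ 3 = c"
    and "(vector [a, b, c, d, e, f] :: 'a^6) $ 4 = d"
    and "(vector [a, b, c, d, e, f] :: 'a^6) $ 5 = e"
    and "(vector [a, b, c, d, e, f] :: 'a^6) $ 6 = f"
  unfolding vector_def by simp_all

text \<open>Each matrix is a quarter of a sum of two rank-one matrices \<open>v v^T\<close>, where
  \<open>v\<close> is a sum or difference of two unit vectors. Each such term contributes one
  square, so nonnegativity can be read off.\<close>

lemma inner_cross_matrices:
  fixes x :: "real^6"
  shows "x \<bullet> (cross_Q1 *v x) = ((x$2 + x$6)\<^sup>2 + (x$3 - x$5)\<^sup>2) / 4"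
    and "x \<bullet> (cross_P1 *v x) = ((x$2 - x$6)\<^sup>2 + (x$3 + x$5)\<^sup>2) / 4"
    and "x \<bullet> (cross_Q2 *v x) = ((x$3 + x$4)\<^sup>2 + (x$1 - x$6)\<^sup>2) / 4"
    and "x \<bullet> (cross_P2 *v x) = ((x$3 - x$4)\<^sup>2 + (x$1 + x$6)\<^sup>2) / 4"
    and "x \<bullet> (cross_Q3 *v x) = ((x$1 + x$5)\<^sup>2 + (x$2 - x$4)\<^sup>2) / 4"
    and "x \<bullet> (cross_P3 *v x) = ((x$1 - x$5)\<^sup>2 + (x$2 + x$4)\<^sup>2) / 4"
  by (simp_all add: cross_Q1_def cross_P1_def cross_Q2_def cross_P2_def cross_Q3_def cross_P3_def
      inner_vec_def matrix_vector_mult_def sum_6 power2_eq_square field_simps)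

lemma transpose_cross_matrices:
  "transpose cross_Q1 = cross_Q1" "transpose cross_P1 = cross_P1"
  "transpose cross_Q2 = cross_Q2" "transpose cross_P2 = cross_P2"
  "transpose cross_Q3 = cross_Q3" "transpose cross_P3 = cross_P3"
  by (simp_all add: cross_Q1_def cross_P1_def cross_Q2_def cross_P2_def cross_Q3_def cross_P3_def
      vec_eq_iff transpose_def forall_6)

lemma cross_matrices_simps:
  "cross_Q 1 = cross_Q1" "cross_Q 2 = cross_Q2" "cross_Q 3 = cross_Q3"
  "cross_P 1 = cross_P1" "cross_P 2 = cross_P2" "cross_P 3 = cross_P3"
  by (simp_all add: cross_Q_def cross_P_def)

lemma psd_cross_Q: "psd (cross_Q i)"
  using exhaust_3[of i]
  by (auto simp: psd_def cross_matrices_simps transpose_cross_matrices inner_cross_matrices)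

lemma psd_cross_P: "psd (cross_P i)"
  using exhaust_3[of i]
  by (auto simp: psd_def cross_matrices_simps transpose_cross_matrices inner_cross_matrices)

text \<open>In the difference of the two forms all pure squares cancel and only the mixed terms
  \<open>u * v\<close> and \<open>- w * z\<close> survive.\<close>

lemma cross_fun_component:
  "cross_fun x $ i = x \<bullet> (cross_Q i *v x) - x \<bullet> (cross_P i *v x)"
  using exhaust_3[of i]
  by (auto simp: cross_fun_def pair_of_def cross3_def cross_matrices_simps inner_cross_matrices
      power2_eq_square field_simps)

lemma Q_pm_rep_cross: "Q_pm_rep cross_fun cross_Q cross_P"
  unfolding Q_pm_rep_def
proof (intro exI conjI allI)
  \<comment> \<open>The cross product is homogeneous of degree two in \<open>x\<close>, so the
    convex part can be taken purely quadratic: the linear and constant terms are zero.\<close>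
  let ?s = "\<lambda>x. \<chi> i. x \<bullet> (cross_Q i *v x)"
  have "?s x $ i = x \<bullet> (cross_Q i *v x) + 0 \<bullet> x + 0" for x i
    by simp
  then show "Q_plus_rep ?s cross_Q"
    unfolding Q_plus_rep_def using psd_cross_Q by blast
  show "psd (cross_P i)" for i
    by (rule psd_cross_P)
  show "cross_fun x $ i = ?s x $ i - x \<bullet> (cross_P i *v x)" for x i
    by (simp add: cross_fun_component)
qed

theorem theorem1:
  shows "cross_fun \<in> Q_pm \<and> Q_pm_rep cross_fun cross_Q cross_P"
  using Q_pm_rep_cross by (auto simp: Q_pm_def)

end
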